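(* Let $k$ be a positive integer and $|q|<1$. Then $$\sum_{m\ge 0} DE_{\ge k}(m)\,q^m=\frac{(q^4;q^4)_\infty\,(q;q)_{k-1}}{(q;q)_\infty}\sum_{n\ge 0}\frac{(q^{k};q^2)_n\,(q^{k+1};q^2)_n\,q^{2n}}{(q^4;q^4)_n}-\frac{(q^4;q^4)_\infty}{(1+q)(q;q)_\infty}\cdot\frac{(q^2;q^2)_{k-1}}{(-q^3;q^2)_{k-1}}.$$
   Context: Notation: for complex $\alpha, q$ with $|q|<1$, $(\alpha;q)_0=1$, $(\alpha;q)_n=\prod_{j=0}^{n-1}(1-\alpha q^j)$ for $n\ge 1$, and $(\alpha;q)_\infty=\prod_{j=0}^\infty(1-\alpha q^j)$. For a positive integer $k$, $DE_{\ge k}(n)$ is the number of partitions of $n$ in which the even parts are distinct and the largest part is odd and appears at least $k$ times; its generating function is $\sum_{n\ge0}DE_{\ge k}(n)q^n=\sum_{n\ge 0}\frac{(-q^2;q^2)_n\,q^{(2n+1)k}}{(q;q^2)_{n+1}}$. *)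

theory Defs
  imports "HOL-Analysis.Analysis" "HOL-Library.Multiset"
begin

definition qpoch :: "complex \<Rightarrow> complex \<Rightarrow> nat \<Rightarrow> complex" where
  "qpoch a q n = (\<Prod>j<n. 1 - a * q ^ j)"

definition qpoch_inf :: "complex \<Rightarrow> complex \<Rightarrow> complex" where
  "qpoch_inf a q = (\<Prod>j. 1 - a * q ^ j)"

text \<open>For \<open>|q| < 1\<close> the product converges, so \<^const>\<open>qpoch_inf\<close> has its intended value.\<close>

lemma qpoch_inf_converges:
  fixes a q :: complex
  assumes "norm q < 1"
  shows "convergent_prod (\<lambda>j. 1 - a * q ^ j)"
proof -
  have "summable (\<lambda>j. norm (1 - a * q ^ j - 1))"
    using assms by (simp add: norm_mult norm_power summable_mult)
  then show ?thesis
    by (intro abs_convergent_prod_imp_convergent_prod summable_imp_abs_convergent_prod)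
qed

text \<open>A partition of \<open>n\<close> is the multiset of its (positive) parts.\<close>

definition partitions_of :: "nat \<Rightarrow> nat multiset set" where
  "partitions_of n = {P. 0 \<notin># P \<and> sum_mset P = n}"

lemma finite_partitions_of: "finite (partitions_of n)"
proof -
  have size: "size P \<le> sum_mset P" if "0 \<notin># P" for P :: "nat multiset"
    using that by (induction P) auto
  have member: "x \<le> sum_mset P" if "x \<in># P" for x and P :: "nat multiset"
    using that by (auto dest: sum_mset.remove)
  have "partitions_of n \<subseteq> (\<Union>k\<le>n. multisets_of_size {..n} k)"
    using size member by (auto simp: partitions_of_def multisets_of_size_def)
  moreover have "finite (\<Union>k\<le>n. multisets_of_size {..n} k)"
    by auto
  ultimately show ?thesis
    by (rule finite_subset)
qed

text \<open>The empty partition has no largest part and is not counted, so \<open>DE_ge k 0 = 0\<close>.\<close>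

definition DE_ge :: "nat \<Rightarrow> nat \<Rightarrow> nat" where
  "DE_ge k n = card {P \<in> partitions_of n.
     (\<forall>p \<in># P. even p \<longrightarrow> count P p = 1) \<and>
     P \<noteq> {#} \<and> odd (Max (set_mset P)) \<and> k \<le> count P (Max (set_mset P))}"

end

theory Submission
  imports Defs
begin

text \<open>
  Write \<open>(a;q)\<^sub>n\<close> for \<^term>\<open>qpoch a q n\<close>, put \<open>k = j + 1\<close>, and sort the partitions by their largest
  part \<open>2n + 1\<close>. This gives the generating function
  \<open>F\<^sub>k = \<Sum>\<^sub>n a\<^sub>n q\<^bsup>(2n+1)k\<^esup>\<close> with
  \<open>a\<^sub>n = (-q\<^sup>2;q\<^sup>2)\<^sub>n / (q;q\<^sup>2)\<^bsub>n+1\<^esub>\<close>, which is \<open>DE_gf q (2 * n + 1)\<close> (\<open>DE_ge_has_sum\<close>). The identity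
  then follows because both sides obey the same first-order recurrence in \<open>k\<close> and have the same limit.

  For \<open>F\<close>, the ratio \<open>a\<^bsub>n+1\<^esub> / a\<^sub>n\<close> yields
  \<open>(1 - q\<^bsup>2k\<^esup>) F\<^sub>k = q\<^sup>k + (1 + q\<^bsup>2k+1\<^esup>) F\<^bsub>k+1\<^esub>\<close> (\<open>DE_series_recurrence\<close>).
  On the other side, \<open>(q;q)\<^sub>j (q\<^sup>k;q\<^sup>2)\<^sub>n (q\<^bsup>k+1\<^esup>;q\<^sup>2)\<^sub>n = (q;q)\<^bsub>j+2n\<^esub>\<close>, so the first sum is
  \<open>S\<^sub>j = \<Sum>\<^sub>n t\<^sub>j(n) q\<^bsup>2n\<^esup>\<close> with \<open>t\<^sub>j(n) = (q;q)\<^bsub>j+2n\<^esub> / (q\<^sup>4;q\<^sup>4)\<^sub>n\<close>. Telescoping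
  \<open>q\<^sup>k (1 - q\<^bsup>4n\<^esup>) t\<^sub>j(n)\<close> shows that \<open>C S\<^sub>j\<close>, where
  \<open>C = (q\<^sup>4;q\<^sup>4)\<^sub>\<infinity> / (q;q)\<^sub>\<infinity>\<close>, satisfies the same recurrence as \<open>F\<^sub>k\<close> (\<open>phi_recurrence\<close>).

  Hence \<open>F\<^sub>k - C S\<^sub>j\<close> solves the homogeneous recurrence, and so does
  \<open>H\<^sub>j = (q\<^sup>2;q\<^sup>2)\<^sub>j / (-q\<^sup>3;q\<^sup>2)\<^sub>j\<close>. Their quotient is constant in \<open>j\<close> and equals its limit. There
  \<open>F\<^sub>k\<close> tends to \<open>0\<close>, and by Euler's sum \<open>\<Sum> z\<^sup>n / (q;q)\<^sub>n = 1 / (z;q)\<^sub>\<infinity>\<close> (with \<open>q\<^sup>2\<close> for \<open>z\<close> and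
  \<open>q\<^sup>4\<close> for \<open>q\<close>) \<open>S\<^sub>j\<close> tends to \<open>(q;q)\<^sub>\<infinity> / (q\<^sup>2;q\<^sup>4)\<^sub>\<infinity> = H\<^sub>\<infinity> / (1 + q)\<close>. The constant is
  therefore \<open>- C / (1 + q)\<close>, which is the second term of the claim.
\<close>

section \<open>Generating functions of partitions with distinct even parts\<close>

definition DE_bounded :: "nat \<Rightarrow> nat multiset set" where
  "DE_bounded m = {P. 0 \<notin># P \<and> (\<forall>p \<in># P. p \<le> m) \<and> (\<forall>p \<in># P. even p \<longrightarrow> count P p = 1)}"

definition DE_mult :: "nat \<Rightarrow> nat set" where
  "DE_mult p = (if even p then {0, 1} else UNIV)"

fun DE_gf :: "'a::real_normed_field \<Rightarrow> nat \<Rightarrow> 'a" where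
  "DE_gf q 0 = 1"
| "DE_gf q (Suc m) = DE_gf q m * (if even (Suc m) then 1 + q ^ Suc m else 1 / (1 - q ^ Suc m))"

text \<open>
  Splitting off all copies of the part \<open>m + 1\<close> leaves a partition with parts at most \<open>m\<close>. The set
  \<open>K\<close> restricts the number of copies: all admissible multiplicities serve for the induction on \<open>m\<close>,
  and the multiplicities at least \<open>k\<close> serve for the largest part.
\<close>

lemma DE_bounded_bij:
  assumes "K \<subseteq> DE_mult (Suc m)"
  shows "bij_betw (\<lambda>(P, i). P + replicate_mset i (Suc m)) (DE_bounded m \<times> K)
           {P \<in> DE_bounded (Suc m). count P (Suc m) \<in> K}"
proof (rule bij_betw_byWitness
    [where f' = "\<lambda>P. (filter_mset (\<lambda>x. x \<noteq> Suc m) P, count P (Suc m))"])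
  have not_in: "Suc m \<notin># P" if "P \<in> DE_bounded m" for P
    using that by (auto simp: DE_bounded_def)
  show "\<forall>a\<in>DE_bounded m \<times> K.
      (filter_mset (\<lambda>x. x \<noteq> Suc m) (case a of (P, i) \<Rightarrow> P + replicate_mset i (Suc m)),
       count (case a of (P, i) \<Rightarrow> P + replicate_mset i (Suc m)) (Suc m)) = a"
    using not_in by (auto simp: multiset_eq_iff not_in_iff)
  show "\<forall>P\<in>{P \<in> DE_bounded (Suc m). count P (Suc m) \<in> K}.
      (case (filter_mset (\<lambda>x. x \<noteq> Suc m) P, count P (Suc m)) of
        (P, i) \<Rightarrow> P + replicate_mset i (Suc m)) = P"
    by (auto simp: multiset_eq_iff)
  show "(\<lambda>(P, i). P + replicate_mset i (Suc m)) ` (DE_bounded m \<times> K)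
      \<subseteq> {P \<in> DE_bounded (Suc m). count P (Suc m) \<in> K}"
  proof safe
    fix P i assume P: "P \<in> DE_bounded m" and i: "i \<in> K"
    have count: "count P (Suc m) = 0"
      using not_in[OF P] by (simp add: not_in_iff)
    show "count (P + replicate_mset i (Suc m)) (Suc m) \<in> K"
      using count i by simp
    show "P + replicate_mset i (Suc m) \<in> DE_bounded (Suc m)"
      using P i assms count not_in[OF P]
      by (force simp: DE_bounded_def DE_mult_def split: if_splits)
  qed
  show "(\<lambda>P. (filter_mset (\<lambda>x. x \<noteq> Suc m) P, count P (Suc m))) `
      {P \<in> DE_bounded (Suc m). count P (Suc m) \<in> K} \<subseteq> DE_bounded m \<times> K"
    by (auto simp: DE_bounded_def le_Suc_eq)
qed

lemma norm_pow_less_1: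
  assumes "norm (q::'a::real_normed_field) < 1" "m > 0"
  shows "norm (q ^ m) < 1"
  using power_strict_mono[OF assms(1) norm_ge_zero assms(2)] by (simp add: norm_power)

text \<open>
  Absolute summability is carried along with the value, since it is what makes the product family
  summable and hence the iteration over further parts possible.
\<close>

lemma has_sum_times:
  fixes f :: "'b \<Rightarrow> 'a::{real_normed_field, banach}" and g :: "'c \<Rightarrow> 'a"
  assumes f: "(\<lambda>x. norm (f x)) summable_on A" "(f has_sum s) A"
    and g: "(\<lambda>y. norm (g y)) summable_on B" "(g has_sum t) B"
  shows "(\<lambda>(x, y). norm (f x * g y)) summable_on A \<times> B"
    and "((\<lambda>(x, y). f x * g y) has_sum s * t) (A \<times> B)"
proof -
  have fg: "((\<lambda>y. norm (f x * g y)) has_sum norm (f x) * (\<Sum>\<^sub>\<infinity>y\<in>B. norm (g y))) B" for x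
    unfolding norm_mult by (intro has_sum_cmult_right has_sum_infsum g)
  have "(\<lambda>x. case x of (x, y) \<Rightarrow> norm (f x * g y)) summable_on A \<times> B"
    by (rule summable_on_SigmaI
        [where g = "\<lambda>x. norm (f x) * (\<Sum>\<^sub>\<infinity>y\<in>B. norm (g y))"])
      (use fg f in \<open>auto intro: summable_on_cmult_left\<close>)
  then show abs: "(\<lambda>(x, y). norm (f x * g y)) summable_on A \<times> B" .
  then have "(\<lambda>z. norm ((\<lambda>(x, y). f x * g y) z)) summable_on A \<times> B"
    by (simp add: case_prod_unfold)
  note sum = abs_summable_summable[OF this]
  show "((\<lambda>(x, y). f x * g y) has_sum s * t) (A \<times> B)"
    by (rule has_sum_SigmaI[where g = "\<lambda>x. f x * t"])
      (use f g sum in \<open>auto intro: has_sum_cmult_right has_sum_cmult_left\<close>)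
qed

lemma has_sum_geometric_from:
  fixes x :: "'a::{real_normed_field, banach}"
  assumes "norm x < 1"
  shows "(\<lambda>i. norm (x ^ i)) summable_on {k..}"
    and "((\<lambda>i. x ^ i) has_sum x ^ k / (1 - x)) {k..}"
proof -
  have bij: "bij_betw (\<lambda>i. i + k) UNIV {k..}"
    by (rule bij_betw_byWitness[where f' = "\<lambda>i. i - k"]) auto
  have "summable (\<lambda>i. norm (x ^ (i + k)))"
    using assms by (simp add: power_add norm_mult norm_power summable_mult2)
  moreover have "(\<lambda>i. x ^ (i + k)) sums (x ^ k / (1 - x))"
    using sums_mult[OF geometric_sums[OF assms], of "x ^ k"] by (simp add: power_add mult.commute)
  ultimately show "((\<lambda>i. x ^ i) has_sum x ^ k / (1 - x)) {k..}"
    by (subst has_sum_reindex_bij_betw[OF bij, symmetric]) (rule norm_summable_imp_has_sum)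
  have "(\<lambda>i. norm (x ^ (i + k))) summable_on UNIV"
    using \<open>summable (\<lambda>i. norm (x ^ (i + k)))\<close> by (intro norm_summable_imp_summable_on) simp
  then show "(\<lambda>i. norm (x ^ i)) summable_on {k..}"
    by (subst summable_on_reindex_bij_betw[OF bij, symmetric])
qed

lemma DE_weights_insert_part:
  fixes q :: "'a::{real_normed_field, banach}"
  assumes "K \<subseteq> DE_mult (Suc m)"
    and P: "(\<lambda>P. norm (q ^ sum_mset P)) summable_on DE_bounded m"
      "((\<lambda>P. q ^ sum_mset P) has_sum s) (DE_bounded m)"
    and K: "(\<lambda>i. norm ((q ^ Suc m) ^ i)) summable_on K" "((\<lambda>i. (q ^ Suc m) ^ i) has_sum t) K"
  shows "(\<lambda>P. norm (q ^ sum_mset P)) summable_on {P \<in> DE_bounded (Suc m). count P (Suc m) \<in> K}"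
    and "((\<lambda>P. q ^ sum_mset P) has_sum s * t) {P \<in> DE_bounded (Suc m). count P (Suc m) \<in> K}"
proof -
  note bij = DE_bounded_bij[OF assms(1)]
  have eq: "(\<lambda>x. q ^ sum_mset (case x of (P, i) \<Rightarrow> P + replicate_mset i (Suc m))) =
      (\<lambda>(P, i). q ^ sum_mset P * (q ^ Suc m) ^ i)"
    by (auto simp: fun_eq_iff power_add power_mult[symmetric] sum_mset_replicate_mset mult.commute
        simp del: power_Suc)
  have norm_eq: "(\<lambda>x. norm (q ^ sum_mset (case x of (P, i) \<Rightarrow> P + replicate_mset i (Suc m)))) =
      (\<lambda>(P, i). norm (q ^ sum_mset P * (q ^ Suc m) ^ i))"
    using eq by (simp add: fun_eq_iff del: power_Suc)
  show "(\<lambda>P. norm (q ^ sum_mset P)) summable_on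
      {P \<in> DE_bounded (Suc m). count P (Suc m) \<in> K}"
    unfolding summable_on_reindex_bij_betw[OF bij, symmetric] norm_eq
    by (rule has_sum_times(1)[OF P K])
  show "((\<lambda>P. q ^ sum_mset P) has_sum s * t) {P \<in> DE_bounded (Suc m). count P (Suc m) \<in> K}"
    unfolding has_sum_reindex_bij_betw[OF bij, symmetric] eq
    by (rule has_sum_times(2)[OF P K])
qed

text \<open>
  The ground field is left general because two instances are needed below: the complex one gives
  the identity, and the real one at \<open>norm q\<close> gives the sum of the absolute values.
\<close>

lemma DE_bounded_gf:
  fixes q :: "'a::{real_normed_field, banach}"
  assumes q: "norm q < 1"
  shows "(\<lambda>P. norm (q ^ sum_mset P)) summable_on DE_bounded m"
    and "((\<lambda>P. q ^ sum_mset P) has_sum DE_gf q m) (DE_bounded m)"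
proof -
  have "(\<lambda>P. norm (q ^ sum_mset P)) summable_on DE_bounded m \<and>
    ((\<lambda>P. q ^ sum_mset P) has_sum DE_gf q m) (DE_bounded m)"
  proof (induction m)
    case 0
    have "P = {#}" if "0 \<notin># P" "\<forall>p \<in># P. p \<le> 0" for P :: "nat multiset"
      using that by (cases P) auto
    then have "DE_bounded 0 = {{#}}"
      by (auto simp: DE_bounded_def)
    then show ?case by (simp add: has_sum_finite_iff)
  next
    case (Suc m)
    let ?t = "if even (Suc m) then 1 + q ^ Suc m else 1 / (1 - q ^ Suc m)"
    have norm: "norm (q ^ Suc m) < 1"
      by (rule norm_pow_less_1[OF q]) simp
    have K: "(\<lambda>i. norm ((q ^ Suc m) ^ i)) summable_on DE_mult (Suc m)"
        "((\<lambda>i. (q ^ Suc m) ^ i) has_sum ?t) (DE_mult (Suc m))"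
    proof -
      consider "even (Suc m)" "DE_mult (Suc m) = {0, 1}" | "odd (Suc m)" "DE_mult (Suc m) = {0..}"
        by (auto simp: DE_mult_def)
      then have "(\<lambda>i. norm ((q ^ Suc m) ^ i)) summable_on DE_mult (Suc m) \<and>
          ((\<lambda>i. (q ^ Suc m) ^ i) has_sum ?t) (DE_mult (Suc m))"
      proof cases
        case 1
        then show ?thesis by (simp add: has_sum_finite_iff del: power_Suc)
      next
        case 2
        then show ?thesis using has_sum_geometric_from[OF norm, of 0]
          by simp
      qed
      then show "(\<lambda>i. norm ((q ^ Suc m) ^ i)) summable_on DE_mult (Suc m)"
        "((\<lambda>i. (q ^ Suc m) ^ i) has_sum ?t) (DE_mult (Suc m))" by blast+
    qed
    have full: "{P \<in> DE_bounded (Suc m). count P (Suc m) \<in> DE_mult (Suc m)} = DE_bounded (Suc m)"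
    proof -
      have "count P (Suc m) \<in> DE_mult (Suc m)" if "P \<in> DE_bounded (Suc m)" for P
        using that by (cases "Suc m \<in># P") (auto simp: DE_bounded_def DE_mult_def not_in_iff)
      then show ?thesis by blast
    qed
    note * = DE_weights_insert_part[OF order_refl conjunct1[OF Suc] conjunct2[OF Suc] K]
    show ?case
      unfolding DE_gf.simps using *[unfolded full] by (rule conjI)
  qed
  then show "(\<lambda>P. norm (q ^ sum_mset P)) summable_on DE_bounded m"
    and "((\<lambda>P. q ^ sum_mset P) has_sum DE_gf q m) (DE_bounded m)" by auto
qed

lemma DE_gf_odd_Suc:
  "DE_gf q (2 * Suc n + 1) = DE_gf q (2 * n + 1) * (1 + q ^ (2 * n + 2)) / (1 - q ^ (2 * n + 3))"
proof -
  have "2 * Suc n + 1 = Suc (Suc (2 * n + 1))" by simp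
  then show ?thesis by (simp del: power_Suc add: numeral_3_eq_3)
qed

definition DE_largest :: "nat \<Rightarrow> nat \<Rightarrow> nat multiset set" where
  "DE_largest k n = {P \<in> DE_bounded (2 * n + 1). k \<le> count P (2 * n + 1)}"

lemma DE_largest_gf:
  fixes q :: "'a::{real_normed_field, banach}"
  assumes q: "norm q < 1"
  shows "((\<lambda>P. q ^ sum_mset P) has_sum DE_gf q (2 * n + 1) * q ^ ((2 * n + 1) * k)) (DE_largest k n)"
proof -
  have "norm (q ^ Suc (2 * n)) < 1"
    by (rule norm_pow_less_1[OF q]) simp
  note K = has_sum_geometric_from[OF this, of k]
  have "{k..} \<subseteq> DE_mult (Suc (2 * n))" by (simp add: DE_mult_def)
  note * = DE_weights_insert_part(2)[OF this DE_bounded_gf[OF q] K]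
  moreover have "{P \<in> DE_bounded (Suc (2 * n)). count P (Suc (2 * n)) \<in> {k..}} = DE_largest k n"
    by (auto simp: DE_largest_def)
  moreover have "DE_gf q (2 * n) * ((q ^ Suc (2 * n)) ^ k / (1 - q ^ Suc (2 * n))) =
      DE_gf q (2 * n + 1) * q ^ ((2 * n + 1) * k)"
    unfolding power_mult[symmetric] by (simp del: power_Suc mult_Suc)
  ultimately show ?thesis by (simp only:)
qed

declare DE_gf.simps(2) [simp del]

text \<open>
  Ratio test: \<open>(1 + q\<^bsup>2n+2\<^esup>) / (1 - q\<^bsup>2n+3\<^esup>)\<close> tends to \<open>1\<close>, so the quotient of successive terms tends
  to \<open>x\<close>.
\<close>

lemma DE_gf_series_summable:
  fixes q x :: "'a::{real_normed_field, banach}"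
  assumes q: "norm q < 1" and x: "norm x < 1"
  shows "summable (\<lambda>n. norm (DE_gf q (2 * n + 1) * x ^ n))"
proof -
  define r where "r n = norm ((1 + q ^ (2 * n + 2)) / (1 - q ^ (2 * n + 3)) * x)" for n
  have "(\<lambda>n. q ^ (2 * n + 2)) \<longlonglongrightarrow> 0" "(\<lambda>n. q ^ (2 * n + 3)) \<longlonglongrightarrow> 0"
    using LIMSEQ_subseq_LIMSEQ[OF LIMSEQ_power_zero[OF q], of "\<lambda>n. 2 * n + 2"]
      LIMSEQ_subseq_LIMSEQ[OF LIMSEQ_power_zero[OF q], of "\<lambda>n. 2 * n + 3"]
    by (simp_all add: strict_mono_def o_def)
  then have "r \<longlonglongrightarrow> norm ((1 + 0) / (1 - 0) * x)"
    unfolding r_def by (intro tendsto_intros) auto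
  then have "\<forall>\<^sub>F n in sequentially. r n < (norm x + 1) / 2"
    \<comment> \<open>Any bound strictly between \<open>norm x\<close> and \<open>1\<close> would do; the midpoint is taken.\<close>
    using x by (intro order_tendstoD(2)[of r "norm x"]) auto
  then obtain N where N: "\<And>n. n \<ge> N \<Longrightarrow> r n < (norm x + 1) / 2"
    by (auto simp: eventually_sequentially)
  show ?thesis
  proof (rule summable_ratio_test[of "(norm x + 1) / 2" N])
    fix n assume "n \<ge> N"
    have "norm (norm (DE_gf q (2 * Suc n + 1) * x ^ Suc n)) = r n * norm (DE_gf q (2 * n + 1) * x ^ n)"
      unfolding DE_gf_odd_Suc r_def by (simp add: norm_mult norm_divide)
    also have "\<dots> \<le> (norm x + 1) / 2 * norm (DE_gf q (2 * n + 1) * x ^ n)"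
      using N[OF \<open>n \<ge> N\<close>] by (intro mult_right_mono) auto
    finally show "norm (norm (DE_gf q (2 * Suc n + 1) * x ^ Suc n)) \<le>
        (norm x + 1) / 2 * norm (norm (DE_gf q (2 * n + 1) * x ^ n))" by simp
  qed (use x in auto)
qed

lemma DE_series_summable:
  fixes q :: "'a::{real_normed_field, banach}"
  assumes q: "norm q < 1" and k: "k \<ge> 1"
  shows "summable (\<lambda>n. norm (DE_gf q (2 * n + 1) * q ^ ((2 * n + 1) * k)))"
proof -
  have "norm (q ^ (2 * k)) < 1"
    by (rule norm_pow_less_1[OF q]) (use k in simp)
  from summable_mult[OF DE_gf_series_summable[OF q this], of "norm (q ^ k)"]
  have "summable (\<lambda>n. norm (q ^ k) * norm (DE_gf q (2 * n + 1) * (q ^ (2 * k)) ^ n))" .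
  moreover have "norm (q ^ k) * norm (DE_gf q (2 * n + 1) * (q ^ (2 * k)) ^ n) =
      norm (DE_gf q (2 * n + 1) * q ^ ((2 * n + 1) * k))" for n
    by (simp add: norm_mult norm_power power_mult[symmetric] power_add add_mult_distrib mult_ac)
  ultimately show ?thesis by (simp only:)
qed

text \<open>
  The partitions counted by \<^const>\<open>DE_ge\<close>, of all numbers at once, so that they can be summed in two
  orders.
\<close>

definition DE_set :: "nat \<Rightarrow> nat multiset set" where
  "DE_set k = {P. 0 \<notin># P \<and> (\<forall>p \<in># P. even p \<longrightarrow> count P p = 1) \<and>
     P \<noteq> {#} \<and> odd (Max (set_mset P)) \<and> k \<le> count P (Max (set_mset P))}"

lemma DE_largest_iff:
  assumes "k \<ge> 1"
  shows "P \<in> DE_largest k n \<longleftrightarrow> P \<in> DE_set k \<and> Max (set_mset P) = 2 * n + 1"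
proof
  assume P: "P \<in> DE_largest k n"
  then have mem: "2 * n + 1 \<in># P"
    using assms by (auto simp: DE_largest_def simp flip: count_greater_zero_iff)
  then have "Max (set_mset P) = 2 * n + 1"
    using P by (intro Max_eqI) (auto simp: DE_largest_def DE_bounded_def)
  with P mem show "P \<in> DE_set k \<and> Max (set_mset P) = 2 * n + 1"
    by (auto simp: DE_set_def DE_largest_def DE_bounded_def)
next
  assume *: "P \<in> DE_set k \<and> Max (set_mset P) = 2 * n + 1"
  have "p \<le> 2 * n + 1" if "p \<in># P" for p
    using * that by (metis Max_ge finite_set_mset)
  with * show "P \<in> DE_largest k n"
    by (auto simp: DE_set_def DE_largest_def DE_bounded_def)
qed

text \<open>
  The sum of \<open>q\<^bsup>sum P\<^esup>\<close> over all counted partitions \<open>P\<close> is evaluated once by fibres of equal largest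
  part and once by fibres of equal sum. The change of order is justified by the real series at
  \<open>norm q\<close>, whose terms are nonnegative and whose fibre sums are summable.
\<close>

lemma DE_ge_has_sum:
  fixes q :: complex
  assumes q: "norm q < 1" and k: "k \<ge> 1"
  shows "((\<lambda>m. of_nat (DE_ge k m) * q ^ m) has_sum
           (\<Sum>n. DE_gf q (2 * n + 1) * q ^ ((2 * n + 1) * k))) UNIV"
proof -
  have bij_max: "bij_betw snd (Sigma UNIV (DE_largest k)) (DE_set k)"
    by (rule bij_betw_byWitness[where f' = "\<lambda>P. (Max (set_mset P) div 2, P)"])
      (auto simp: DE_largest_iff[OF k] DE_set_def)
  define D where "D m = {P \<in> DE_set k. sum_mset P = m}" for m
  have bij_sum: "bij_betw snd (Sigma UNIV D) (DE_set k)"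
    by (rule bij_betw_byWitness[where f' = "\<lambda>P. (sum_mset P, P)"]) (auto simp: D_def)
  have D: "finite (D m)" "card (D m) = DE_ge k m" for m
  proof -
    have "D m = {P \<in> partitions_of m.
     (\<forall>p \<in># P. even p \<longrightarrow> count P p = 1) \<and>
     P \<noteq> {#} \<and> odd (Max (set_mset P)) \<and> k \<le> count P (Max (set_mset P))}"
      by (auto simp: D_def DE_set_def partitions_of_def)
    then show "finite (D m)" "card (D m) = DE_ge k m"
      using finite_partitions_of[of m] by (auto simp: DE_ge_def)
  qed
  define r where "r = norm q"
  have r: "0 \<le> r" "norm r < 1" using q by (auto simp: r_def)
  have "(\<lambda>x. r ^ sum_mset (snd x)) summable_on Sigma UNIV (DE_largest k)"
  proof (rule summable_on_SigmaI)
    show "(\<lambda>n. DE_gf r (2 * n + 1) * r ^ ((2 * n + 1) * k)) summable_on UNIV"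
      by (rule norm_summable_imp_summable_on[OF DE_series_summable[OF r(2) k]])
  qed (use DE_largest_gf[OF r(2)] r in auto)
  then have "(\<lambda>x. q ^ sum_mset (snd x)) summable_on Sigma UNIV (DE_largest k)"
    unfolding r_def norm_power[symmetric] by (rule abs_summable_summable)
  then have "((\<lambda>x. q ^ sum_mset (snd x)) has_sum
      (\<Sum>n. DE_gf q (2 * n + 1) * q ^ ((2 * n + 1) * k))) (Sigma UNIV (DE_largest k))"
  proof (rule has_sum_SigmaI[rotated 2])
    show "((\<lambda>n. DE_gf q (2 * n + 1) * q ^ ((2 * n + 1) * k)) has_sum
      (\<Sum>n. DE_gf q (2 * n + 1) * q ^ ((2 * n + 1) * k))) UNIV"
      using DE_series_summable[OF q k]
        summable_sums[OF summable_norm_cancel[OF DE_series_summable[OF q k]]]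
      by (rule norm_summable_imp_has_sum)
  qed (use DE_largest_gf[OF q] in auto)
  then have "((\<lambda>P. q ^ sum_mset P) has_sum
      (\<Sum>n. DE_gf q (2 * n + 1) * q ^ ((2 * n + 1) * k))) (DE_set k)"
    by (subst (asm) has_sum_reindex_bij_betw[OF bij_max])
  then have "((\<lambda>x. q ^ sum_mset (snd x)) has_sum
      (\<Sum>n. DE_gf q (2 * n + 1) * q ^ ((2 * n + 1) * k))) (Sigma UNIV D)"
    by (subst has_sum_reindex_bij_betw[OF bij_sum])
  then show ?thesis
  proof (rule has_sum_SigmaD)
    fix m
    have "(\<Sum>P\<in>D m. q ^ sum_mset P) = (\<Sum>P\<in>D m. q ^ m)"
      by (rule sum.cong) (auto simp: D_def)
    then show "((\<lambda>P. q ^ sum_mset (snd (m, P))) has_sum of_nat (DE_ge k m) * q ^ m) (D m)"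
      using D by (simp add: has_sum_finite_iff)
  qed
qed

section \<open>q-Pochhammer symbols and an Euler sum\<close>

lemma qpoch_0 [simp]: "qpoch a q 0 = 1"
  and qpoch_Suc: "qpoch a q (Suc n) = qpoch a q n * (1 - a * q ^ n)"
  by (simp_all add: qpoch_def)

lemma qpoch_Suc_shift: "qpoch a q (Suc n) = (1 - a) * qpoch (a * q) q n"
  by (simp add: qpoch_def prod.lessThan_Suc_shift mult.assoc del: prod.lessThan_Suc)

lemma qpoch_bisect: "qpoch a q (2 * n) = qpoch a (q\<^sup>2) n * qpoch (a * q) (q\<^sup>2) n"
  by (induction n) (simp_all add: qpoch_Suc power_mult[symmetric] mult_ac)

lemma qpoch_square: "qpoch (a\<^sup>2) (q\<^sup>2) n = qpoch a q n * qpoch (- a) q n"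
proof (induction n)
  case (Suc n)
  have "1 - a\<^sup>2 * (q\<^sup>2) ^ n = (1 - a * q ^ n) * (1 - (- a) * q ^ n)"
    by (simp add: algebra_simps power2_eq_square power_mult_distrib)
  then show ?case using Suc by (simp add: qpoch_Suc)
qed simp

lemma qpoch_append: "qpoch a q (j + n) = qpoch a q j * qpoch (a * q ^ j) q n"
  by (induction n) (simp_all add: qpoch_Suc power_add mult.assoc)

lemma qpoch_tendsto:
  assumes "norm q < 1"
  shows "qpoch a q \<longlonglongrightarrow> qpoch_inf a q"
proof -
  have "(\<lambda>n. \<Prod>j<n. 1 - a * q ^ j) \<longlonglongrightarrow> (\<Prod>j. 1 - a * q ^ j)"
    using convergent_prod_LIMSEQ[OF qpoch_inf_converges[OF assms, of a]]
    by (simp only: LIMSEQ_lessThan_iff_atMost)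
  then show ?thesis unfolding qpoch_def[abs_def] qpoch_inf_def .
qed

lemma qpoch_factor_nonzero:
  assumes "norm q < 1" "norm a < 1"
  shows "1 - a * q ^ j \<noteq> (0::complex)"
proof
  assume "1 - a * q ^ j = 0"
  then have "norm (a * q ^ j) = 1" by (metis eq_iff_diff_eq_0 norm_one)
  moreover have "norm (a * q ^ j) \<le> norm a * 1"
    using assms(1) unfolding norm_mult norm_power
    by (intro mult_left_mono power_le_one) auto
  ultimately show False using assms(2) by simp
qed

lemma qpoch_nonzero:
  assumes "norm q < 1" "norm a < 1"
  shows "qpoch a q n \<noteq> 0"
  using qpoch_factor_nonzero[OF assms] by (simp add: qpoch_def)

lemma qpoch_inf_nonzero:
  assumes "norm q < 1" "norm a < 1"
  shows "qpoch_inf a q \<noteq> 0"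
  unfolding qpoch_inf_def
  using qpoch_inf_converges[OF assms(1)] qpoch_factor_nonzero[OF assms]
  by (rule prodinf_nonzero)

text \<open>
  Numerator and denominator converge and the limit of the denominator is not zero. The bound is
  uniform in both indices, which gives a dominating series that does not depend on \<open>j\<close> below.
\<close>

lemma qpoch_ratio_bounded:
  assumes "norm q < 1" "norm b < 1" "norm p < 1"
  obtains B where "\<And>m n. norm (qpoch a p m / qpoch b q n) \<le> B"
proof -
  obtain B1 where B1: "\<And>m. norm (qpoch a p m) \<le> B1"
    using convergent_imp_Bseq[OF convergentI[OF qpoch_tendsto[OF assms(3), of a]]]
    unfolding Bseq_def by blast
  have lim: "(\<lambda>n. inverse (qpoch b q n)) \<longlonglongrightarrow> inverse (qpoch_inf b q)"
    by (intro tendsto_inverse qpoch_tendsto qpoch_inf_nonzero assms)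
  then obtain B2 where B2: "\<And>n. norm (inverse (qpoch b q n)) \<le> B2"
    using convergent_imp_Bseq[OF convergentI[OF lim]] unfolding Bseq_def by blast
  have "0 \<le> B1" using B1[of 0] norm_ge_zero order_trans by blast
  have "norm (qpoch a p m / qpoch b q n) \<le> B1 * B2" for m n
    unfolding divide_inverse norm_mult by (intro mult_mono B1 B2 \<open>0 \<le> B1\<close>) simp
  then show ?thesis by (rule that)
qed

lemma euler_sum_summable:
  assumes "norm q < 1" "norm z < 1"
  shows "summable (\<lambda>n. norm (inverse (qpoch q q n) * z ^ n))"
proof -
  \<comment> \<open>Only \<open>(0;q)\<^sub>0 = 1\<close> is used, so that \<open>B\<close> bounds the reciprocals \<open>1 / (q;q)\<^sub>n\<close>.\<close>
  obtain B where B: "\<And>m n. norm (qpoch 0 q m / qpoch q q n) \<le> B"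
    using qpoch_ratio_bounded[OF assms(1,1,1)] by blast
  show ?thesis
  proof (rule summable_comparison_test')
    show "summable (\<lambda>n. B * norm z ^ n)" using assms(2) by (intro summable_mult) simp
    show "norm (norm (inverse (qpoch q q n) * z ^ n)) \<le> B * norm z ^ n" for n
      using mult_right_mono[OF B[of 0 n], of "norm z ^ n"]
      by (simp add: norm_mult norm_power norm_divide norm_inverse divide_inverse)
  qed
qed

text \<open>
  Write \<open>E(z)\<close> for the series. Since \<open>(1 - q\<^sup>n) / (q;q)\<^sub>n = 1 / (q;q)\<^bsub>n-1\<^esub>\<close>, it satisfies
  \<open>E(z) - E(zq) = z E(z)\<close>. Iterating gives \<open>E(z) (z;q)\<^sub>N = E(z q\<^sup>N)\<close>, and the right side tends to
  \<open>E(0) = 1\<close> by continuity.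
\<close>

lemma euler_sum:
  assumes q: "norm q < 1" and z: "norm z < 1"
  shows "(\<Sum>n. inverse (qpoch q q n) * z ^ n) = 1 / qpoch_inf z q"
proof -
  define E where "E w = (\<Sum>n. inverse (qpoch q q n) * w ^ n)" for w
  have small: "norm (z * q ^ N) < 1" for N
  proof -
    have "norm z * norm q ^ N \<le> norm z * 1" using q by (intro mult_left_mono power_le_one) auto
    then show ?thesis using z by (simp add: norm_mult norm_power)
  qed
  have summable: "summable (\<lambda>n. inverse (qpoch q q n) * w ^ n)" if "norm w < 1" for w
    using euler_sum_summable[OF q that] by (rule summable_norm_cancel)
  have step: "E (z * q ^ N) * (1 - z * q ^ N) = E (z * q ^ Suc N)" for N
  proof -
    let ?w = "z * q ^ N" and ?c = "\<lambda>n. inverse (qpoch q q n)"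
    have sw: "(\<lambda>n. ?c n * ?w ^ n) sums E ?w"
      unfolding E_def by (intro summable_sums summable small)
    have "(\<lambda>n. ?c n * (z * q ^ Suc N) ^ n) sums E (z * q ^ Suc N)"
      unfolding E_def by (intro summable_sums summable small)
    from sums_diff[OF sw this]
    have "(\<lambda>n. ?c n * (1 - q ^ n) * ?w ^ n) sums (E ?w - E (z * q ^ Suc N))"
      by (simp add: algebra_simps power_mult_distrib power_mult[symmetric])
    then have "(\<lambda>n. ?c (Suc n) * (1 - q ^ Suc n) * ?w ^ Suc n) sums (E ?w - E (z * q ^ Suc N))"
      unfolding sums_Suc_iff[of "\<lambda>n. ?c n * (1 - q ^ n) * ?w ^ n"] by simp
    moreover have "?c (Suc n) * (1 - q ^ Suc n) = ?c n" for n
      using qpoch_factor_nonzero[OF q q, of n] by (simp add: qpoch_Suc)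
    ultimately have "(\<lambda>n. ?w * (?c n * ?w ^ n)) sums (E ?w - E (z * q ^ Suc N))"
      by (simp add: mult_ac del: power_Suc) (simp add: mult_ac)
    from sums_unique2[OF this sums_mult[OF sw, of ?w]] show ?thesis
      by (simp add: algebra_simps)
  qed
  have iter: "E z * qpoch z q N = E (z * q ^ N)" for N
  proof (induction N)
    case (Suc N)
    then show ?case using step[of N] by (simp add: qpoch_Suc mult.assoc[symmetric])
  qed simp
  have "isCont E 0"
    unfolding E_def by (rule isCont_powser[where K = "1 / 2"]) (auto intro: summable)
  moreover have "(\<lambda>N. z * q ^ N) \<longlonglongrightarrow> 0"
    using LIMSEQ_power_zero[OF q] by (rule tendsto_mult_right_zero)
  ultimately have "(\<lambda>N. E (z * q ^ N)) \<longlonglongrightarrow> E 0" by (rule isCont_tendsto_compose)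
  moreover have "E 0 = 1" by (simp add: E_def)
  moreover have "(\<lambda>N. E (z * q ^ N)) \<longlonglongrightarrow> E z * qpoch_inf z q"
    unfolding iter[symmetric] by (intro tendsto_intros qpoch_tendsto q)
  ultimately have "E z * qpoch_inf z q = 1" by (metis LIMSEQ_unique)
  then show ?thesis
    using qpoch_inf_nonzero[OF q z] by (simp add: E_def field_simps)
qed

section \<open>The partition series as a function of the multiplicity\<close>

text \<open>
  In \<open>F\<^sub>k - F\<^bsub>k+1\<^esub>\<close> the coefficient \<open>a\<^sub>n\<close> is multiplied by \<open>1 - q\<^bsup>2n+1\<^esup>\<close>, which turns it into
  \<open>(1 + q\<^bsup>2n\<^esup>) a\<^bsub>n-1\<^esub>\<close> for \<open>n \<ge> 1\<close>. After an index shift the two summands are multiples of \<open>F\<^sub>k\<close>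
  and \<open>F\<^bsub>k+1\<^esub>\<close>, and the term \<open>n = 0\<close> contributes \<open>q\<^sup>k\<close>.
\<close>

lemma DE_series_recurrence:
  fixes q :: complex
  assumes q: "norm q < 1" and k: "k \<ge> 1"
  defines "F \<equiv> \<lambda>k. \<Sum>n. DE_gf q (2 * n + 1) * q ^ ((2 * n + 1) * k)"
  shows "(1 - q ^ (2 * k)) * F k = q ^ k + (1 + q ^ (2 * k + 1)) * F (Suc k)"
proof -
  let ?a = "\<lambda>n. DE_gf q (2 * n + 1)"
  have F: "(\<lambda>n. ?a n * q ^ ((2 * n + 1) * k)) sums F k" if "k \<ge> 1" for k
    unfolding F_def
    by (intro summable_sums summable_norm_cancel[OF DE_series_summable] q that)
  have nz: "1 - q ^ Suc n \<noteq> 0" for n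
    using qpoch_factor_nonzero[OF q q, of n] by simp
  have F1: "(\<lambda>n. ?a n * q ^ ((2 * n + 1) * Suc k)) sums F (Suc k)" by (rule F) simp
  have "(\<lambda>n. ?a n * (1 - q ^ (2 * n + 1)) * q ^ ((2 * n + 1) * k)) sums (F k - F (Suc k))"
    using sums_diff[OF F[OF k] F1]
    by (simp add: right_diff_distrib left_diff_distrib power_add mult_ac)
  moreover have "?a 0 * (1 - q ^ (2 * 0 + 1)) * q ^ ((2 * 0 + 1) * k) = q ^ k"
    using nz[of 0] by (simp add: DE_gf.simps)
  ultimately have "(\<lambda>n. ?a (Suc n) * (1 - q ^ (2 * Suc n + 1)) * q ^ ((2 * Suc n + 1) * k))
      sums (F k - F (Suc k) - q ^ k)"
    by (subst sums_Suc_iff[of "\<lambda>n. ?a n * (1 - q ^ (2 * n + 1)) * q ^ ((2 * n + 1) * k)"])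
      (simp only: diff_add_cancel)
  moreover have "?a (Suc n) * (1 - q ^ (2 * Suc n + 1)) * q ^ ((2 * Suc n + 1) * k) =
      q ^ (2 * k) * (?a n * q ^ ((2 * n + 1) * k)) +
      q ^ (2 * k + 1) * (?a n * q ^ ((2 * n + 1) * Suc k))" for n
  proof -
    have "?a (Suc n) * (1 - q ^ (2 * Suc n + 1)) = ?a n * (1 + q ^ (2 * n + 2))"
      using nz[of "2 * n + 2"] unfolding DE_gf_odd_Suc by (simp add: eval_nat_numeral)
    moreover have "q ^ ((2 * Suc n + 1) * k) = q ^ (2 * k) * q ^ ((2 * n + 1) * k)"
      "q ^ (2 * n + 2) * q ^ ((2 * Suc n + 1) * k) =
        q ^ (2 * k + 1) * q ^ ((2 * n + 1) * Suc k)"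
      unfolding power_add[symmetric] by (rule arg_cong[of _ _ "power q"], simp)+
    ultimately show ?thesis
      by (simp only: distrib_left distrib_right mult_1_right mult_1_left mult_ac)
  qed
  ultimately have "(\<lambda>n. q ^ (2 * k) * (?a n * q ^ ((2 * n + 1) * k)) +
      q ^ (2 * k + 1) * (?a n * q ^ ((2 * n + 1) * Suc k))) sums (F k - F (Suc k) - q ^ k)"
    by simp
  from sums_unique2[OF this sums_add[OF sums_mult[OF F[OF k]] sums_mult[OF F1]]]
  show ?thesis by (simp add: algebra_simps)
qed

text \<open>
  Every exponent \<open>(2n + 1)(j + 1)\<close> is at least \<open>(2n + 1) + j\<close>, so the series is bounded by
  \<open>norm q ^ j\<close> times the sum of the absolute values for \<open>j = 0\<close>.
\<close>

lemma DE_series_tendsto_0: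
  fixes q :: complex
  assumes q: "norm q < 1"
  shows "(\<lambda>j. \<Sum>n. DE_gf q (2 * n + 1) * q ^ ((2 * n + 1) * Suc j)) \<longlonglongrightarrow> 0"
proof (rule Lim_null_comparison)
  let ?M = "\<lambda>n. norm (DE_gf q (2 * n + 1) * q ^ ((2 * n + 1) * 1))"
  have M: "summable ?M" by (rule DE_series_summable[OF q]) simp
  have le: "norm (DE_gf q (2 * n + 1) * q ^ ((2 * n + 1) * Suc j)) \<le> norm q ^ j * ?M n" for n j
  proof -
    have "norm q ^ ((2 * n + 1) * j) \<le> norm q ^ j"
      using q by (intro power_decreasing) auto
    then have "norm q ^ ((2 * n + 1) * j) * ?M n \<le> norm q ^ j * ?M n"
      by (rule mult_right_mono) simp
    then show ?thesis
      by (simp add: norm_mult norm_power power_add mult_ac)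
  qed
  show "\<forall>\<^sub>F j in sequentially. norm (\<Sum>n. DE_gf q (2 * n + 1) * q ^ ((2 * n + 1) * Suc j))
      \<le> norm q ^ j * suminf ?M"
  proof (intro always_eventually allI)
    fix j
    have "norm (\<Sum>n. DE_gf q (2 * n + 1) * q ^ ((2 * n + 1) * Suc j))
      \<le> (\<Sum>n. norm (DE_gf q (2 * n + 1) * q ^ ((2 * n + 1) * Suc j)))"
      by (rule summable_norm[OF DE_series_summable[OF q]]) simp
    also have "\<dots> \<le> (\<Sum>n. norm q ^ j * ?M n)"
      by (rule suminf_le[OF le DE_series_summable[OF q] summable_mult[OF M]]) simp
    also have "\<dots> = norm q ^ j * suminf ?M" by (rule suminf_mult[OF M])
    finally show "norm (\<Sum>n. DE_gf q (2 * n + 1) * q ^ ((2 * n + 1) * Suc j))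
      \<le> norm q ^ j * suminf ?M" .
  qed
  show "(\<lambda>j. norm q ^ j * suminf ?M) \<longlonglongrightarrow> 0"
    by (rule tendsto_mult_left_zero) (use q in \<open>simp add: LIMSEQ_power_zero\<close>)
qed

section \<open>The basic hypergeometric side\<close>

definition phi_term :: "complex \<Rightarrow> nat \<Rightarrow> nat \<Rightarrow> complex" where
  "phi_term q j n = qpoch q q (j + 2 * n) / qpoch (q ^ 4) (q ^ 4) n"

lemma phi_term_eq:
  "qpoch q q j * (qpoch (q ^ Suc j) (q\<^sup>2) n * qpoch (q ^ (Suc j + 1)) (q\<^sup>2) n * q ^ (2 * n)
     / qpoch (q ^ 4) (q ^ 4) n) = phi_term q j n * q ^ (2 * n)"
  using qpoch_bisect[of "q ^ Suc j" q n]
  by (simp add: phi_term_def qpoch_append mult_ac)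

lemma phi_term_bounded:
  assumes "norm q < 1"
  obtains B where "\<And>j n. norm (phi_term q j n) \<le> B"
  unfolding phi_term_def
  using qpoch_ratio_bounded[of "q ^ 4" "q ^ 4" q q] norm_pow_less_1[OF assms] assms
  by (metis zero_less_numeral)

lemma phi_summable:
  assumes "norm q < 1"
  shows "summable (\<lambda>n. phi_term q j n * q ^ (2 * n))"
proof -
  obtain B where B: "\<And>j n. norm (phi_term q j n) \<le> B"
    using phi_term_bounded[OF assms] by blast
  show ?thesis
  proof (rule summable_comparison_test')
    have "norm ((norm q)\<^sup>2) < 1" using norm_pow_less_1[OF assms, of 2] by (simp add: norm_power)
    then show "summable (\<lambda>n. B * ((norm q)\<^sup>2) ^ n)" by (intro summable_mult summable_geometric)
    show "norm (phi_term q j n * q ^ (2 * n)) \<le> B * ((norm q)\<^sup>2) ^ n" for n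
      by (simp add: norm_mult norm_power power_mult B mult_right_mono)
  qed
qed

lemma phi_term_tendsto:
  assumes "norm q < 1"
  shows "phi_term q j \<longlonglongrightarrow> qpoch_inf q q / qpoch_inf (q ^ 4) (q ^ 4)"
proof -
  have "strict_mono (\<lambda>n. j + 2 * n)" by (simp add: strict_mono_def)
  from LIMSEQ_subseq_LIMSEQ[OF qpoch_tendsto[OF assms, of q] this]
  have "(\<lambda>n. qpoch q q (j + 2 * n)) \<longlonglongrightarrow> qpoch_inf q q" by (simp add: o_def)
  then show ?thesis
    unfolding phi_term_def[abs_def]
    by (intro tendsto_divide qpoch_tendsto qpoch_inf_nonzero norm_pow_less_1 assms) auto
qed

text \<open>
  The sequence \<open>q\<^bsup>j+1\<^esup> (1 - q\<^bsup>4n\<^esup>) t\<^sub>j(n)\<close> starts at \<open>0\<close>. The factor \<open>1 - q\<^bsup>4n\<^esup>\<close> cancels the newest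
  factor of the denominator of \<open>t\<^sub>j(n)\<close>, so the difference of consecutive terms is a polynomial in \<open>q\<close>,
  \<open>x = q\<^bsup>2n\<^esup>\<close> and \<open>y = q\<^bsup>j+1\<^esup>\<close> times \<open>t\<^sub>j(n)\<close>. As \<open>t\<^bsub>j+1\<^esub>(n) = (1 - xy) t\<^sub>j(n)\<close>, that polynomial is the
  combination of the summands of \<open>S\<^sub>j\<close> and \<open>S\<^bsub>j+1\<^esub>\<close> in the recurrence; the inhomogeneous term is the
  limit of the sequence.
\<close>

lemma phi_recurrence:
  assumes q: "norm q < 1"
  defines "S \<equiv> \<lambda>j. \<Sum>n. phi_term q j n * q ^ (2 * n)"
  shows "(1 - q ^ (2 * Suc j)) * S j =
    q ^ Suc j * (qpoch_inf q q / qpoch_inf (q ^ 4) (q ^ 4)) + (1 + q ^ (2 * Suc j + 1)) * S (Suc j)"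
proof -
  define u where "u n = q ^ Suc j * (1 - q ^ (4 * n)) * phi_term q j n" for n
  have S: "(\<lambda>n. phi_term q j n * q ^ (2 * n)) sums S j" for j
    unfolding S_def by (intro summable_sums phi_summable q)
  have "strict_mono (\<lambda>n. 4 * n :: nat)" by (simp add: strict_mono_def)
  from LIMSEQ_subseq_LIMSEQ[OF LIMSEQ_power_zero[OF q] this]
  have "(\<lambda>n. q ^ (4 * n)) \<longlonglongrightarrow> 0" by (simp add: o_def)
  then have "u \<longlonglongrightarrow> q ^ Suc j * (1 - 0) * (qpoch_inf q q / qpoch_inf (q ^ 4) (q ^ 4))"
    unfolding u_def[abs_def] by (intro tendsto_intros phi_term_tendsto q)
  from telescope_sums[OF this]
  have u_sums: "(\<lambda>n. u (Suc n) - u n) sums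
      (q ^ Suc j * (qpoch_inf q q / qpoch_inf (q ^ 4) (q ^ 4)))"
    by (simp add: u_def)
  have "u (Suc n) - u n = (1 - q ^ (2 * Suc j)) * (phi_term q j n * q ^ (2 * n)) -
      (1 + q ^ (2 * Suc j + 1)) * (phi_term q (Suc j) n * q ^ (2 * n))" for n
  proof -
    define x y t where "x = q ^ (2 * n)" and "y = q ^ Suc j" and "t = phi_term q j n"
    have nz: "1 - q ^ 4 * (q ^ 4) ^ n \<noteq> 0"
      using norm_pow_less_1[OF q, of 4] by (intro qpoch_factor_nonzero) auto
    have q4: "q ^ (4 * Suc n) = q ^ 4 * (q ^ 4) ^ n"
      by (simp only: power_mult power_Suc)
    have "qpoch q q (j + 2 * Suc n) = qpoch q q (j + 2 * n) * (1 - y * x) * (1 - y * x * q)"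
      by (simp add: qpoch_Suc x_def y_def power_add mult_ac)
    then have "phi_term q j (Suc n) * (1 - q ^ (4 * Suc n)) = t * (1 - y * x) * (1 - y * x * q)"
      using nz unfolding q4 by (simp add: phi_term_def t_def qpoch_Suc)
    then have u1: "u (Suc n) = y * (t * (1 - y * x) * (1 - y * x * q))"
      by (simp add: u_def y_def mult_ac del: power_Suc)
    have "q ^ (4 * n) = x\<^sup>2" by (simp add: x_def power_mult[symmetric])
    then have u0: "u n = y * (1 - x\<^sup>2) * t" by (simp add: u_def y_def t_def)
    have p1: "phi_term q (Suc j) n = t * (1 - y * x)"
      by (simp add: phi_term_def t_def x_def y_def qpoch_Suc power_add mult_ac)
    have "q ^ (2 * Suc j) = y\<^sup>2" by (simp only: y_def power_mult[symmetric] mult.commute)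
    then show ?thesis
      unfolding u1 u0 p1 power_add t_def[symmetric] x_def[symmetric]
      by (simp add: algebra_simps power2_eq_square)
  qed
  then have "(\<lambda>n. u (Suc n) - u n) sums
      ((1 - q ^ (2 * Suc j)) * S j - (1 + q ^ (2 * Suc j + 1)) * S (Suc j))"
    using sums_diff[OF sums_mult[OF S[of j]] sums_mult[OF S[of "Suc j"]]] by presburger
  from sums_unique2[OF this u_sums] show ?thesis by (simp add: algebra_simps)
qed

text \<open>
  The limit may be taken termwise, where \<open>(q;q)\<^bsub>j+2n\<^esub>\<close> becomes \<open>(q;q)\<^sub>\<infinity>\<close>; what remains is Euler's sum
  for \<open>z = q\<^sup>2\<close> in base \<open>q\<^sup>4\<close>.
\<close>

lemma phi_tendsto:
  assumes q: "norm q < 1"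
  shows "(\<lambda>j. \<Sum>n. phi_term q j n * q ^ (2 * n)) \<longlonglongrightarrow> qpoch_inf q q / qpoch_inf (q\<^sup>2) (q ^ 4)"
proof -
  have q2: "norm (q\<^sup>2) < 1" and q4: "norm (q ^ 4) < 1" using norm_pow_less_1[OF q] by auto
  let ?b = "\<lambda>n. qpoch_inf q q / qpoch (q ^ 4) (q ^ 4) n * q ^ (2 * n)"
  obtain B where B: "\<And>j n. norm (phi_term q j n) \<le> B"
    using phi_term_bounded[OF q] by blast
  have "(\<lambda>j. \<Sum>n. phi_term q j n * q ^ (2 * n)) \<longlonglongrightarrow> suminf ?b"
  proof (rule tannerys_theorem[THEN conjunct2, THEN conjunct2])
    show "(\<lambda>j. phi_term q j n * q ^ (2 * n)) \<longlonglongrightarrow> ?b n" for n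
      unfolding phi_term_def
      by (intro tendsto_intros LIMSEQ_ignore_initial_segment[OF qpoch_tendsto[OF q]]
          qpoch_nonzero q4)
    show "\<forall>\<^sub>F (n, j) in at_top \<times>\<^sub>F sequentially.
        norm (phi_term q j n * q ^ (2 * n)) \<le> B * (norm (q\<^sup>2)) ^ n"
      by (intro always_eventually)
        (auto simp: norm_mult norm_power power_mult B intro!: mult_right_mono)
    show "summable (\<lambda>n. B * (norm (q\<^sup>2)) ^ n)"
      using q2 by (intro summable_mult summable_geometric) simp
  qed simp
  also have "suminf ?b = qpoch_inf q q * (\<Sum>n. inverse (qpoch (q ^ 4) (q ^ 4) n) * (q\<^sup>2) ^ n)"
    using summable_norm_cancel[OF euler_sum_summable[OF q4 q2]]
    by (subst suminf_mult[symmetric]) (auto simp: divide_inverse mult.assoc power_mult[of q 2])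
  also have "\<dots> = qpoch_inf q q / qpoch_inf (q\<^sup>2) (q ^ 4)"
    by (simp add: euler_sum[OF q4 q2])
  finally show ?thesis .
qed

text \<open>
  Both sides come from splitting \<open>(q;q)\<close> into \<open>(q;q\<^sup>2) (q\<^sup>2;q\<^sup>2)\<close> and \<open>(q\<^sup>2;q\<^sup>4)\<close> into
  \<open>(q;q\<^sup>2) (-q;q\<^sup>2)\<close>. The splitting is done for finite products, where \<open>1 + q (q\<^sup>2)\<^sup>n\<close> is the factor left
  over when the first factor \<open>1 + q\<close> is taken off \<open>(-q;q\<^sup>2)\<close>; it tends to \<open>1\<close>.
\<close>

lemma qpoch_inf_quotient:
  assumes q: "norm q < 1"
  shows "qpoch_inf q q / qpoch_inf (q\<^sup>2) (q ^ 4) =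
    (qpoch_inf (q\<^sup>2) (q\<^sup>2) / qpoch_inf (- (q ^ 3)) (q\<^sup>2)) / (1 + q)"
proof -
  have q2: "norm (q\<^sup>2) < 1" and q4: "norm (q ^ 4) < 1" and q3: "norm (- (q ^ 3)) < 1"
    using norm_pow_less_1[OF q] by auto
  have fin: "qpoch q q (2 * n) * ((1 + q) * qpoch (- (q ^ 3)) (q\<^sup>2) n) =
      qpoch (q\<^sup>2) (q\<^sup>2) n * (qpoch (q\<^sup>2) (q ^ 4) n * (1 + q * (q\<^sup>2) ^ n))" for n
  proof -
    have "(1 + q) * qpoch (- (q ^ 3)) (q\<^sup>2) n = qpoch (- q) (q\<^sup>2) n * (1 + q * (q\<^sup>2) ^ n)"
      using qpoch_Suc_shift[of "- q" "q\<^sup>2" n] qpoch_Suc[of "- q" "q\<^sup>2" n]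
      by (simp add: eval_nat_numeral mult.assoc)
    moreover have "qpoch (q\<^sup>2) (q ^ 4) n = qpoch q (q\<^sup>2) n * qpoch (- q) (q\<^sup>2) n"
      using qpoch_square[of q "q\<^sup>2" n] by (simp add: power_mult[symmetric])
    moreover have "qpoch q q (2 * n) = qpoch q (q\<^sup>2) n * qpoch (q\<^sup>2) (q\<^sup>2) n"
      using qpoch_bisect[of q q n] by (simp add: power2_eq_square)
    ultimately show ?thesis by (simp add: mult_ac)
  qed
  have "strict_mono (\<lambda>n. 2 * n :: nat)" by (simp add: strict_mono_def)
  from LIMSEQ_subseq_LIMSEQ[OF qpoch_tendsto[OF q, of q] this]
  have "(\<lambda>n. qpoch q q (2 * n)) \<longlonglongrightarrow> qpoch_inf q q" by (simp add: o_def)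
  then have lim1: "(\<lambda>n. qpoch q q (2 * n) * ((1 + q) * qpoch (- (q ^ 3)) (q\<^sup>2) n)) \<longlonglongrightarrow>
      qpoch_inf q q * ((1 + q) * qpoch_inf (- (q ^ 3)) (q\<^sup>2))"
    by (intro tendsto_intros qpoch_tendsto q2)
  have "(\<lambda>n. qpoch (q\<^sup>2) (q\<^sup>2) n * (qpoch (q\<^sup>2) (q ^ 4) n * (1 + q * (q\<^sup>2) ^ n))) \<longlonglongrightarrow>
      qpoch_inf (q\<^sup>2) (q\<^sup>2) * (qpoch_inf (q\<^sup>2) (q ^ 4) * (1 + q * 0))"
    by (intro tendsto_intros qpoch_tendsto q2 q4 LIMSEQ_power_zero)
  with lim1 have "qpoch_inf q q * ((1 + q) * qpoch_inf (- (q ^ 3)) (q\<^sup>2)) =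
      qpoch_inf (q\<^sup>2) (q\<^sup>2) * qpoch_inf (q\<^sup>2) (q ^ 4)"
    unfolding fin by (auto dest: LIMSEQ_unique)
  moreover have "1 + q \<noteq> 0"
    using qpoch_factor_nonzero[OF q, of "- q" 0] q by simp
  ultimately show ?thesis
    using qpoch_inf_nonzero[OF q4 q2] qpoch_inf_nonzero[OF q2 q3]
    by (simp add: frac_eq_eq mult_ac)
qed

text \<open>
  The quotient \<open>d\<close> of two solutions of the same homogeneous first-order recurrence is constant, so it
  can be read off in the limit.
\<close>

lemma DE_series_eq:
  fixes q :: complex
  assumes q: "norm q < 1"
  defines "C \<equiv> qpoch_inf (q ^ 4) (q ^ 4) / qpoch_inf q q"
  shows "(\<Sum>n. DE_gf q (2 * n + 1) * q ^ ((2 * n + 1) * Suc j)) =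
    C * (\<Sum>n. phi_term q j n * q ^ (2 * n))
    - C / (1 + q) * (qpoch (q\<^sup>2) (q\<^sup>2) j / qpoch (- (q ^ 3)) (q\<^sup>2) j)"
proof -
  define F where "F j = (\<Sum>n. DE_gf q (2 * n + 1) * q ^ ((2 * n + 1) * j))" for j
  define S where "S j = (\<Sum>n. phi_term q j n * q ^ (2 * n))" for j
  define H where "H j = qpoch (q\<^sup>2) (q\<^sup>2) j / qpoch (- (q ^ 3)) (q\<^sup>2) j" for j
  define H_inf where "H_inf = qpoch_inf (q\<^sup>2) (q\<^sup>2) / qpoch_inf (- (q ^ 3)) (q\<^sup>2)"
  define d where "d j = (F (Suc j) - C * S j) / H j" for j
  have q2: "norm (q\<^sup>2) < 1" and q4: "norm (q ^ 4) < 1" and q3: "norm (- (q ^ 3)) < 1"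
    using norm_pow_less_1[OF q] by auto
  have H_nz: "H j \<noteq> 0" for j
    unfolding H_def using qpoch_nonzero[OF q2 q2] qpoch_nonzero[OF q2 q3] by simp
  have H_inf_nz: "H_inf \<noteq> 0"
    unfolding H_inf_def using qpoch_inf_nonzero[OF q2 q2] qpoch_inf_nonzero[OF q2 q3] by simp
  have "d (Suc j) = d j" for j
  proof -
    let ?a = "1 - q ^ (2 * Suc j)" and ?b = "1 + q ^ (2 * Suc j + 1)"
    have a: "1 - q\<^sup>2 * (q\<^sup>2) ^ j = ?a" and b: "1 - - (q ^ 3) * (q\<^sup>2) ^ j = ?b"
      by (simp_all add: power_mult[symmetric] power_add[symmetric] numeral_3_eq_3 del: power_Suc)
    have nz: "?a \<noteq> 0" "?b \<noteq> 0"
      using qpoch_factor_nonzero[OF q2 q2, of j] qpoch_factor_nonzero[OF q2 q3, of j]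
      unfolding a b by auto
    have CC: "C * (qpoch_inf q q / qpoch_inf (q ^ 4) (q ^ 4)) = 1"
      using qpoch_inf_nonzero[OF q q] qpoch_inf_nonzero[OF q4 q4] by (simp add: C_def)
    have "?a * (C * S j) = C * (?a * S j)" by simp
    also have "\<dots> = C * (qpoch_inf q q / qpoch_inf (q ^ 4) (q ^ 4)) * q ^ Suc j +
        ?b * (C * S (Suc j))"
      unfolding S_def phi_recurrence[OF q] by (simp only: algebra_simps)
    finally have "?a * (C * S j) = q ^ Suc j + ?b * (C * S (Suc j))"
      unfolding CC by simp
    moreover have "?a * F (Suc j) = q ^ Suc j + ?b * F (Suc (Suc j))"
      unfolding F_def by (rule DE_series_recurrence[OF q]) simp
    ultimately have "?a * (F (Suc j) - C * S j) = ?b * (F (Suc (Suc j)) - C * S (Suc j))"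
      by (simp only: right_diff_distrib) simp
    then have "F (Suc (Suc j)) - C * S (Suc j) = ?a / ?b * (F (Suc j) - C * S j)"
      using nz by (simp only: eq_divide_eq times_divide_eq_left if_False) (simp add: mult.commute)
    moreover have "H (Suc j) = ?a / ?b * H j"
      unfolding H_def qpoch_Suc a b by (simp add: mult.commute)
    ultimately show ?thesis
      unfolding d_def using nz by simp
  qed
  then have const: "d j = d 0" for j by (induction j) auto
  have "H \<longlonglongrightarrow> H_inf"
    unfolding H_def[abs_def] H_inf_def
    by (intro tendsto_divide qpoch_tendsto q2 qpoch_inf_nonzero q3)
  moreover have "(\<lambda>j. F (Suc j)) \<longlonglongrightarrow> 0"
    unfolding F_def by (rule DE_series_tendsto_0[OF q])
  moreover have "S \<longlonglongrightarrow> H_inf / (1 + q)"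
    using phi_tendsto[OF q] unfolding S_def[abs_def] H_inf_def qpoch_inf_quotient[OF q] .
  ultimately have "d \<longlonglongrightarrow> (0 - C * (H_inf / (1 + q))) / H_inf"
    unfolding d_def[abs_def] by (intro tendsto_intros H_inf_nz)
  moreover have "d \<longlonglongrightarrow> d j"
    using const by (metis (no_types, lifting) LIMSEQ_I diff_self norm_zero)
  ultimately have "d j = - (C / (1 + q))"
    using H_inf_nz by (auto dest: LIMSEQ_unique)
  then have "F (Suc j) - C * S j = - (C / (1 + q)) * H j"
    unfolding d_def using H_nz by (simp only: divide_eq_eq) simp
  then show ?thesis unfolding F_def S_def H_def by (simp add: algebra_simps)
qed

theorem theorem1:
  fixes k :: nat and q :: complex
  assumes "k \<ge> 1" and "norm q < 1"
  shows "summable (\<lambda>n. qpoch (q ^ k) (q\<^sup>2) n * qpoch (q ^ (k + 1)) (q\<^sup>2) n * q ^ (2 * n)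
                        / qpoch (q ^ 4) (q ^ 4) n)
    \<and> summable (\<lambda>m. of_nat (DE_ge k m) * q ^ m)
    \<and> (\<Sum>m. of_nat (DE_ge k m) * q ^ m) =
        qpoch_inf (q ^ 4) (q ^ 4) * qpoch q q (k - 1) / qpoch_inf q q
          * (\<Sum>n. qpoch (q ^ k) (q\<^sup>2) n * qpoch (q ^ (k + 1)) (q\<^sup>2) n * q ^ (2 * n)
                   / qpoch (q ^ 4) (q ^ 4) n)
        - qpoch_inf (q ^ 4) (q ^ 4) / ((1 + q) * qpoch_inf q q)
          * (qpoch (q\<^sup>2) (q\<^sup>2) (k - 1) / qpoch (- (q ^ 3)) (q\<^sup>2) (k - 1))"
proof -
  obtain j where k: "k = Suc j" using assms(1) by (cases k) auto
  let ?g = "\<lambda>n. qpoch (q ^ k) (q\<^sup>2) n * qpoch (q ^ (k + 1)) (q\<^sup>2) n * q ^ (2 * n)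
                        / qpoch (q ^ 4) (q ^ 4) n"
  have g: "(\<lambda>n. qpoch q q j * ?g n) = (\<lambda>n. phi_term q j n * q ^ (2 * n))"
    unfolding k by (rule ext) (rule phi_term_eq)
  have nz: "qpoch q q j \<noteq> 0" by (rule qpoch_nonzero) (rule assms)+
  have "summable (\<lambda>n. qpoch q q j * ?g n)"
    unfolding g by (rule phi_summable[OF assms(2)])
  then have summable: "summable ?g"
    using nz by (simp only: summable_cmult_iff) simp
  have sum: "(\<Sum>n. phi_term q j n * q ^ (2 * n)) = qpoch q q j * suminf ?g"
    unfolding g[symmetric] by (rule suminf_mult[OF summable])
  have DE: "(\<lambda>m. of_nat (DE_ge k m) * q ^ m) sums
      (\<Sum>n. DE_gf q (2 * n + 1) * q ^ ((2 * n + 1) * k))"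
    by (rule has_sum_imp_sums[OF DE_ge_has_sum[OF assms(2,1)]])
  show ?thesis
  proof (intro conjI)
    show "summable ?g" by (rule summable)
    show "summable (\<lambda>m. of_nat (DE_ge k m) * q ^ m)" using DE by (rule sums_summable)
    show "(\<Sum>m. of_nat (DE_ge k m) * q ^ m) =
        qpoch_inf (q ^ 4) (q ^ 4) * qpoch q q (k - 1) / qpoch_inf q q * suminf ?g
        - qpoch_inf (q ^ 4) (q ^ 4) / ((1 + q) * qpoch_inf q q)
          * (qpoch (q\<^sup>2) (q\<^sup>2) (k - 1) / qpoch (- (q ^ 3)) (q\<^sup>2) (k - 1))"
      unfolding sums_unique[OF DE, symmetric]
      unfolding k DE_series_eq[OF assms(2)]
      unfolding sum[unfolded k] by (simp add: mult_ac)
  qed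
qed

end
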